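(* (Introduction property.) Let $t$ be a closed irreducible proof-term of $A$ in the $\mathcal{L}^{\mathcal S}_2$-calculus. Then: $A$ is not a proposition variable $X$; if $A=\mathbf 1$ then $t=a.\star$ for some $a\in\mathcal S$; if $A=B\multimap C$ then $t=\lambda x^B.u$; if $A=B\otimes C$ then $t$ has the form $u\otimes v$, $u\boxplus v$, or $a\bullet u$; if $A=\top$ then $t=\langle\rangle$; $A$ is not $\mathbf 0$; if $A=B\& C$ then $t=\langle u,v\rangle$; if $A=B\oplus C$ then $t$ has the form $\mathrm{inl}(u)$, $\mathrm{inr}(u)$, $u\boxplus v$, or $a\bullet u$; if $A=\,!B$ then $t=\,!u$; if $A=\forall X.B$ then $t=\Lambda X.u$.
   Context: Let $\mathcal S$ be a semiring. Propositions (modulo $\alpha$): $A ::= X \mid \mathbf 1 \mid A\multimap A\mid A\otimes A\mid \top\mid \mathbf 0\mid A\,\&\,A\mid A\oplus A\mid\, !A\mid \forall X.A$. Proof-terms (modulo $\alpha$; $a\in\mathcal S$): $t ::= x \mid t\boxplus u\mid a\bullet t\mid a.\star\mid \delta_{\mathbf 1}(t,u)\mid \lambda x^A.t\mid t\,u\mid t\otimes u\mid \delta_\otimes(t,x^Ay^B.u)\mid\langle\rangle\mid \delta_{\mathbf 0}(t) \mid \langle t,u\rangle\mid \delta^1_\&(t,x^A.u)\mid\delta^2_\&(t,x^B.u)\mid \mathrm{inl}(t)\mid\mathrm{inr}(t)\mid\delta_\oplus(t,x^A.u,y^B.v)\mid\, !t\mid\delta_!(t,x^A.u)\mid\Lambda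 X.t\mid t\,A$ ($\boxplus$: proof-term sum). Typing rules for $\Xi;\Gamma\vdash t:A$ ($\Xi$ non-linear, $\Gamma$ linear; $\Gamma,\Delta$ disjoint union): $\Xi;x^A\vdash x:A$; $\Xi,x^A;\varnothing\vdash x:A$; from $\Xi;\Gamma\vdash t:A$ and $\Xi;\Gamma\vdash u:A$ infer $\Xi;\Gamma\vdash t\boxplus u:A$; from $\Xi;\Gamma\vdash t:A$ infer $\Xi;\Gamma\vdash a\bullet t:A$; $\Xi;\varnothing\vdash a.\star:\mathbf 1$; from $\Xi;\Gamma\vdash t:\mathbf 1$, $\Xi;\Delta\vdash u:A$ infer $\Xi;\Gamma,\Delta\vdash \delta_{\mathbf 1}(t,u):A$; from $\Xi;\Gamma,x^A\vdash t:B$ infer $\Xi;\Gamma\vdash \lambda x^A.t:A\multimap B$; from $\Xi;\Gamma\vdash t:A\multimap B$, $\Xi;\Delta\vdash u:A$ infer $\Xi;\Gamma,\Delta\vdash t\,u:B$; from $\Xi;\Gamma\vdash t:A$, $\Xi;\Delta\vdash u:B$ infer $\Xi;\Gamma,\Delta\vdash t\otimes u:A\otimes B$; from $\Xi;\Gamma\vdash t:A\otimes B$, $\Xi;\Delta,x^A,y^B\vdash u:C$ infer $\Xi;\Gamma,\Delta\vdash\delta_\otimes(t,x^Ay^B.u):C$; $\Xi;\Gamma\vdash\langle\rangle:\top$; from $\Xi;\Gamma\vdash t:\mathbf 0$ infer $\Xi;\Gamma,\Delta\vdash\delta_{\mathbf 0}(t):C$; from $\Xi;\Gamma\vdash t:A$,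 $\Xi;\Gamma\vdash u:B$ infer $\Xi;\Gamma\vdash\langle t,u\rangle:A\&B$; from $\Xi;\Gamma\vdash t:A\&B$, $\Xi;\Delta,x^A\vdash u:C$ infer $\Xi;\Gamma,\Delta\vdash\delta^1_\&(t,x^A.u):C$; from $\Xi;\Gamma\vdash t:A\&B$, $\Xi;\Delta,x^B\vdash u:C$ infer $\Xi;\Gamma,\Delta\vdash\delta^2_\&(t,x^B.u):C$; from $\Xi;\Gamma\vdash t:A$ infer $\Xi;\Gamma\vdash\mathrm{inl}(t):A\oplus B$; from $\Xi;\Gamma\vdash t:B$ infer $\Xi;\Gamma\vdash\mathrm{inr}(t):A\oplus B$; from $\Xi;\Gamma\vdash t:A\oplus B$, $\Xi;\Delta,x^A\vdash u:C$, $\Xi;\Delta,y^B\vdash v:C$ infer $\Xi;\Gamma,\Delta\vdash\delta_\oplus(t,x^A.u,y^B.v):C$; from $\Xi;\varnothing\vdash t:A$ infer $\Xi;\varnothing\vdash\, !t:\,!A$; from $\Xi;\Gamma\vdash t:\,!A$, $\Xi,x^A;\Delta\vdash u:B$ infer $\Xi;\Gamma,\Delta\vdash\delta_!(t,x^A.u):B$; from $\Xi;\Gamma\vdash t:A$ with $X\notin FV(\Xi,\Gamma)$ infer $\Xi;\Gamma\vdash\Lambda X.t:\forall X.A$; from $\Xi;\Gamma\vdash t:\forall X.B$ infer $\Xi;\Gamma\vdash t\,A:(A/X)B$. Reduction $\to$ is the closure under all proof-term contexts of: $\delta_{\mathbf 1}(a.\star,t)\to a\bullet t$; $(\lambda x^A.t)\,u\to(u/x)t$;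 $\delta_\otimes(u\otimes v,x^Ay^B.w)\to(u/x,v/y)w$; $\delta^i_\&(\langle t_1,t_2\rangle,x.v)\to(t_i/x)v$; $\delta_\oplus(\mathrm{inl}(t),x^A.v,y^B.w)\to(t/x)v$; $\delta_\oplus(\mathrm{inr}(u),x^A.v,y^B.w)\to(u/y)w$; $\delta_!(!t,x^A.u)\to(t/x)u$; $(\Lambda X.t)\,A\to(A/X)t$; $a.\star\boxplus b.\star\to(a+b).\star$; $(\lambda x^A.t)\boxplus(\lambda x^A.u)\to\lambda x^A.(t\boxplus u)$; $\delta_\otimes(t\boxplus u,x^Ay^B.v)\to\delta_\otimes(t,x^Ay^B.v)\boxplus\delta_\otimes(u,x^Ay^B.v)$; $\langle\rangle\boxplus\langle\rangle\to\langle\rangle$; $\langle t,u\rangle\boxplus\langle v,w\rangle\to\langle t\boxplus v,u\boxplus w\rangle$; $\delta_\oplus(t\boxplus u,x^A.v,y^B.w)\to\delta_\oplus(t,x^A.v,y^B.w)\boxplus\delta_\oplus(u,x^A.v,y^B.w)$; $!t\boxplus !u\to !(t\boxplus u)$; $(\Lambda X.t)\boxplus(\Lambda X.u)\to\Lambda X.(t\boxplus u)$; $a\bullet b.\star\to(a\times b).\star$; $a\bullet\lambda x^A.t\to\lambda x^A.a\bullet t$; $\delta_\otimes(a\bullet t,x^Ay^B.v)\to a\bullet\delta_\otimes(t,x^Ay^B.v)$; $a\bullet\langle\rangle\to\langle\rangle$; $a\bullet\langle t,u\rangle\to\langle a\bullet t,a\bullet u\rangle$; $\delta_\oplus(a\bullet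 t,x^A.v,y^B.w)\to a\bullet\delta_\oplus(t,x^A.v,y^B.w)$; $a\bullet !t\to !(a\bullet t)$; $a\bullet\Lambda X.t\to\Lambda X.a\bullet t$. A closed irreducible proof-term of $A$ is a proof-term with no free proof-term variables, to which no reduction rule applies, and which is typable with proposition $A$ by the rules above. *)

theory Defs
  imports Main
begin

text \<open>
  Propositions and proof-terms modulo alpha are represented with de Bruijn indices. There are two
  independent index spaces: proposition variables, bound by \<open>Forall\<close> and \<open>TLam\<close>, and proof-term
  variables (linear and non-linear ones alike), bound by all the other binders.
\<close>

datatype lprop =
    PVar nat
  | One
  | Lolli lprop lprop
  | Tensor lprop lprop
  | Top
  | Zero
  | With lprop lprop
  | Plus lprop lprop
  | OfCourse lprop
  | Forall lprop

text \<open>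
  \<open>Scal a t\<close> is \<open>a \<bullet> t\<close> and \<open>Star a\<close> is \<open>a.\<star>\<close>. In \<open>TensE t A B u\<close>, which is
  \<open>\<delta>\<^sub>\<otimes>(t, x\<^sup>A y\<^sup>B. u)\<close>, index 1 of \<open>u\<close> is \<open>x\<close> and index 0 is \<open>y\<close>.
  \<open>PlusE t A u B v\<close> is \<open>\<delta>\<^sub>\<oplus>(t, x\<^sup>A. u, y\<^sup>B. v)\<close>.
\<close>

datatype 's trm =
    Var nat
  | Sum "'s trm" "'s trm"
  | Scal 's "'s trm"
  | Star 's
  | OneE "'s trm" "'s trm"
  | Lam lprop "'s trm"
  | App "'s trm" "'s trm"
  | Tens "'s trm" "'s trm"
  | TensE "'s trm" lprop lprop "'s trm"
  | Unit
  | ZeroE "'s trm"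
  | Pair "'s trm" "'s trm"
  | With1E "'s trm" lprop "'s trm"
  | With2E "'s trm" lprop "'s trm"
  | Inl "'s trm"
  | Inr "'s trm"
  | PlusE "'s trm" lprop "'s trm" lprop "'s trm"
  | Bang "'s trm"
  | BangE "'s trm" lprop "'s trm"
  | TLam "'s trm"
  | TApp "'s trm" lprop


subsection \<open>Substitution of propositions\<close>

text \<open>\<open>case_nat 0 (Suc \<circ> r)\<close> is the renaming \<open>r\<close> pushed under one binder.\<close>

primrec prename :: "(nat \<Rightarrow> nat) \<Rightarrow> lprop \<Rightarrow> lprop" where
  "prename r (PVar X) = PVar (r X)"
| "prename r One = One"
| "prename r (Lolli A B) = Lolli (prename r A) (prename r B)"
| "prename r (Tensor A B) = Tensor (prename r A) (prename r B)"
| "prename r Top = Top"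
| "prename r Zero = Zero"
| "prename r (With A B) = With (prename r A) (prename r B)"
| "prename r (Plus A B) = Plus (prename r A) (prename r B)"
| "prename r (OfCourse A) = OfCourse (prename r A)"
| "prename r (Forall A) = Forall (prename (case_nat 0 (Suc \<circ> r)) A)"

definition pup :: "(nat \<Rightarrow> lprop) \<Rightarrow> nat \<Rightarrow> lprop" where
  "pup \<theta> = case_nat (PVar 0) (prename Suc \<circ> \<theta>)"

primrec psubst :: "(nat \<Rightarrow> lprop) \<Rightarrow> lprop \<Rightarrow> lprop" where
  "psubst \<theta> (PVar X) = \<theta> X"
| "psubst \<theta> One = One"
| "psubst \<theta> (Lolli A B) = Lolli (psubst \<theta> A) (psubst \<theta> B)"
| "psubst \<theta> (Tensor A B) = Tensor (psubst \<theta> A) (psubst \<theta> B)"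
| "psubst \<theta> Top = Top"
| "psubst \<theta> Zero = Zero"
| "psubst \<theta> (With A B) = With (psubst \<theta> A) (psubst \<theta> B)"
| "psubst \<theta> (Plus A B) = Plus (psubst \<theta> A) (psubst \<theta> B)"
| "psubst \<theta> (OfCourse A) = OfCourse (psubst \<theta> A)"
| "psubst \<theta> (Forall A) = Forall (psubst (pup \<theta>) A)"

text \<open>\<open>(A/X)B\<close>, where \<open>X\<close> is index 0 of \<open>B\<close>.\<close>

definition pinst :: "lprop \<Rightarrow> lprop \<Rightarrow> lprop" where
  "pinst A B = psubst (case_nat A PVar) B"

primrec tsubst :: "(nat \<Rightarrow> lprop) \<Rightarrow> 's trm \<Rightarrow> 's trm" where
  "tsubst \<theta> (Var x) = Var x"
| "tsubst \<theta> (Sum t u) = Sum (tsubst \<theta> t) (tsubst \<theta> u)"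
| "tsubst \<theta> (Scal a t) = Scal a (tsubst \<theta> t)"
| "tsubst \<theta> (Star a) = Star a"
| "tsubst \<theta> (OneE t u) = OneE (tsubst \<theta> t) (tsubst \<theta> u)"
| "tsubst \<theta> (Lam A t) = Lam (psubst \<theta> A) (tsubst \<theta> t)"
| "tsubst \<theta> (App t u) = App (tsubst \<theta> t) (tsubst \<theta> u)"
| "tsubst \<theta> (Tens t u) = Tens (tsubst \<theta> t) (tsubst \<theta> u)"
| "tsubst \<theta> (TensE t A B u) = TensE (tsubst \<theta> t) (psubst \<theta> A) (psubst \<theta> B) (tsubst \<theta> u)"
| "tsubst \<theta> Unit = Unit"
| "tsubst \<theta> (ZeroE t) = ZeroE (tsubst \<theta> t)"
| "tsubst \<theta> (Pair t u) = Pair (tsubst \<theta> t) (tsubst \<theta> u)"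
| "tsubst \<theta> (With1E t A u) = With1E (tsubst \<theta> t) (psubst \<theta> A) (tsubst \<theta> u)"
| "tsubst \<theta> (With2E t B u) = With2E (tsubst \<theta> t) (psubst \<theta> B) (tsubst \<theta> u)"
| "tsubst \<theta> (Inl t) = Inl (tsubst \<theta> t)"
| "tsubst \<theta> (Inr t) = Inr (tsubst \<theta> t)"
| "tsubst \<theta> (PlusE t A u B v) =
     PlusE (tsubst \<theta> t) (psubst \<theta> A) (tsubst \<theta> u) (psubst \<theta> B) (tsubst \<theta> v)"
| "tsubst \<theta> (Bang t) = Bang (tsubst \<theta> t)"
| "tsubst \<theta> (BangE t A u) = BangE (tsubst \<theta> t) (psubst \<theta> A) (tsubst \<theta> u)"
| "tsubst \<theta> (TLam t) = TLam (tsubst (pup \<theta>) t)"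
| "tsubst \<theta> (TApp t A) = TApp (tsubst \<theta> t) (psubst \<theta> A)"

text \<open>\<open>(A/X)t\<close>, where \<open>X\<close> is index 0 of \<open>t\<close>.\<close>

definition tinst :: "lprop \<Rightarrow> 's trm \<Rightarrow> 's trm" where
  "tinst A t = tsubst (case_nat A PVar) t"


subsection \<open>Substitution of proof-terms\<close>

primrec rename :: "(nat \<Rightarrow> nat) \<Rightarrow> 's trm \<Rightarrow> 's trm" where
  "rename r (Var x) = Var (r x)"
| "rename r (Sum t u) = Sum (rename r t) (rename r u)"
| "rename r (Scal a t) = Scal a (rename r t)"
| "rename r (Star a) = Star a"
| "rename r (OneE t u) = OneE (rename r t) (rename r u)"
| "rename r (Lam A t) = Lam A (rename (case_nat 0 (Suc \<circ> r)) t)"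
| "rename r (App t u) = App (rename r t) (rename r u)"
| "rename r (Tens t u) = Tens (rename r t) (rename r u)"
| "rename r (TensE t A B u) =
     TensE (rename r t) A B (rename (case_nat 0 (Suc \<circ> case_nat 0 (Suc \<circ> r))) u)"
| "rename r Unit = Unit"
| "rename r (ZeroE t) = ZeroE (rename r t)"
| "rename r (Pair t u) = Pair (rename r t) (rename r u)"
| "rename r (With1E t A u) = With1E (rename r t) A (rename (case_nat 0 (Suc \<circ> r)) u)"
| "rename r (With2E t B u) = With2E (rename r t) B (rename (case_nat 0 (Suc \<circ> r)) u)"
| "rename r (Inl t) = Inl (rename r t)"
| "rename r (Inr t) = Inr (rename r t)"
| "rename r (PlusE t A u B v) =
     PlusE (rename r t) A (rename (case_nat 0 (Suc \<circ> r)) u) B (rename (case_nat 0 (Suc \<circ> r)) v)"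
| "rename r (Bang t) = Bang (rename r t)"
| "rename r (BangE t A u) = BangE (rename r t) A (rename (case_nat 0 (Suc \<circ> r)) u)"
| "rename r (TLam t) = TLam (rename r t)"
| "rename r (TApp t A) = TApp (rename r t) A"

definition up :: "(nat \<Rightarrow> 's trm) \<Rightarrow> nat \<Rightarrow> 's trm" where
  "up \<sigma> = case_nat (Var 0) (rename Suc \<circ> \<sigma>)"

text \<open>
  Simultaneous substitution. Under \<open>TLam\<close> the proposition variables occurring in the substituted
  proof-terms have to be shifted.
\<close>

primrec subst :: "(nat \<Rightarrow> 's trm) \<Rightarrow> 's trm \<Rightarrow> 's trm" where
  "subst \<sigma> (Var x) = \<sigma> x"
| "subst \<sigma> (Sum t u) = Sum (subst \<sigma> t) (subst \<sigma> u)"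
| "subst \<sigma> (Scal a t) = Scal a (subst \<sigma> t)"
| "subst \<sigma> (Star a) = Star a"
| "subst \<sigma> (OneE t u) = OneE (subst \<sigma> t) (subst \<sigma> u)"
| "subst \<sigma> (Lam A t) = Lam A (subst (up \<sigma>) t)"
| "subst \<sigma> (App t u) = App (subst \<sigma> t) (subst \<sigma> u)"
| "subst \<sigma> (Tens t u) = Tens (subst \<sigma> t) (subst \<sigma> u)"
| "subst \<sigma> (TensE t A B u) = TensE (subst \<sigma> t) A B (subst (up (up \<sigma>)) u)"
| "subst \<sigma> Unit = Unit"
| "subst \<sigma> (ZeroE t) = ZeroE (subst \<sigma> t)"
| "subst \<sigma> (Pair t u) = Pair (subst \<sigma> t) (subst \<sigma> u)"
| "subst \<sigma> (With1E t A u) = With1E (subst \<sigma> t) A (subst (up \<sigma>) u)"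
| "subst \<sigma> (With2E t B u) = With2E (subst \<sigma> t) B (subst (up \<sigma>) u)"
| "subst \<sigma> (Inl t) = Inl (subst \<sigma> t)"
| "subst \<sigma> (Inr t) = Inr (subst \<sigma> t)"
| "subst \<sigma> (PlusE t A u B v) = PlusE (subst \<sigma> t) A (subst (up \<sigma>) u) B (subst (up \<sigma>) v)"
| "subst \<sigma> (Bang t) = Bang (subst \<sigma> t)"
| "subst \<sigma> (BangE t A u) = BangE (subst \<sigma> t) A (subst (up \<sigma>) u)"
| "subst \<sigma> (TLam t) = TLam (subst (tsubst (PVar \<circ> Suc) \<circ> \<sigma>) t)"
| "subst \<sigma> (TApp t A) = TApp (subst \<sigma> t) A"

text \<open>\<open>(u/x)t\<close>, where \<open>x\<close> is index 0 of \<open>t\<close>.\<close>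

definition inst :: "'s trm \<Rightarrow> 's trm \<Rightarrow> 's trm" where
  "inst u t = subst (case_nat u Var) t"

text \<open>\<open>(u/x, v/y)t\<close>, where \<open>x\<close> is index 1 and \<open>y\<close> is index 0 of \<open>t\<close>.\<close>

definition inst2 :: "'s trm \<Rightarrow> 's trm \<Rightarrow> 's trm \<Rightarrow> 's trm" where
  "inst2 u v t = subst (case_nat v (case_nat u Var)) t"

text \<open>Free proof-term variables.\<close>

primrec fv :: "'s trm \<Rightarrow> nat set" where
  "fv (Var x) = {x}"
| "fv (Sum t u) = fv t \<union> fv u"
| "fv (Scal a t) = fv t"
| "fv (Star a) = {}"
| "fv (OneE t u) = fv t \<union> fv u"
| "fv (Lam A t) = {x. Suc x \<in> fv t}"
| "fv (App t u) = fv t \<union> fv u"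
| "fv (Tens t u) = fv t \<union> fv u"
| "fv (TensE t A B u) = fv t \<union> {x. Suc (Suc x) \<in> fv u}"
| "fv Unit = {}"
| "fv (ZeroE t) = fv t"
| "fv (Pair t u) = fv t \<union> fv u"
| "fv (With1E t A u) = fv t \<union> {x. Suc x \<in> fv u}"
| "fv (With2E t B u) = fv t \<union> {x. Suc x \<in> fv u}"
| "fv (Inl t) = fv t"
| "fv (Inr t) = fv t"
| "fv (PlusE t A u B v) = fv t \<union> {x. Suc x \<in> fv u} \<union> {x. Suc x \<in> fv v}"
| "fv (Bang t) = fv t"
| "fv (BangE t A u) = fv t \<union> {x. Suc x \<in> fv u}"
| "fv (TLam t) = fv t"
| "fv (TApp t A) = fv t"


subsection \<open>Typing\<close>

type_synonym ctx = "nat \<rightharpoonup> lprop"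

text \<open>
  \<open>extend A \<Gamma>\<close> is \<open>\<Gamma>, x\<^sup>A\<close> under the binder of \<open>x\<close>; \<open>skip \<Gamma>\<close> is \<open>\<Gamma>\<close> under the binder of a variable
  that is not declared in \<open>\<Gamma>\<close>; \<open>shift \<Gamma>\<close> is \<open>\<Gamma>\<close> under the binder of a proposition variable.
\<close>

definition extend :: "lprop \<Rightarrow> ctx \<Rightarrow> ctx" where
  "extend A \<Gamma> = case_nat (Some A) \<Gamma>"

definition skip :: "ctx \<Rightarrow> ctx" where
  "skip \<Gamma> = case_nat None \<Gamma>"

definition shift :: "ctx \<Rightarrow> ctx" where
  "shift \<Gamma> = map_option (prename Suc) \<circ> \<Gamma>"

definition disjoint :: "ctx \<Rightarrow> ctx \<Rightarrow> bool" where
  "disjoint \<Gamma> \<Delta> \<longleftrightarrow> dom \<Gamma> \<inter> dom \<Delta> = {}"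

definition wf_ctx :: "ctx \<Rightarrow> ctx \<Rightarrow> bool" where
  "wf_ctx \<Xi> \<Gamma> \<longleftrightarrow> finite (dom \<Xi>) \<and> finite (dom \<Gamma>) \<and> disjoint \<Xi> \<Gamma>"

text \<open>
  \<open>\<Xi>\<close> is the non-linear and \<open>\<Gamma>\<close> the linear part. Every derivable judgement has \<open>wf_ctx \<Xi> \<Gamma>\<close>
  (see \<open>typing_wf_ctx\<close> below), so it is only required at the leaves and where the linear context is
  weakened. The shifted contexts in \<open>TLam\<close> express that the generalized proposition variable is not
  free in \<open>\<Xi>, \<Gamma>\<close>.
\<close>

inductive typing :: "ctx \<Rightarrow> ctx \<Rightarrow> 's trm \<Rightarrow> lprop \<Rightarrow> bool"
  ("_ ; _ \<turnstile> _ \<Colon> _" [50, 50, 50, 50] 50) where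
  lin_ax: "wf_ctx \<Xi> [x \<mapsto> A] \<Longrightarrow> \<Xi>; [x \<mapsto> A] \<turnstile> Var x \<Colon> A"
| ax: "wf_ctx \<Xi> Map.empty \<Longrightarrow> \<Xi> x = Some A \<Longrightarrow> \<Xi>; Map.empty \<turnstile> Var x \<Colon> A"
| Sum: "\<Xi>; \<Gamma> \<turnstile> t \<Colon> A \<Longrightarrow> \<Xi>; \<Gamma> \<turnstile> u \<Colon> A \<Longrightarrow> \<Xi>; \<Gamma> \<turnstile> Sum t u \<Colon> A"
| Scal: "\<Xi>; \<Gamma> \<turnstile> t \<Colon> A \<Longrightarrow> \<Xi>; \<Gamma> \<turnstile> Scal a t \<Colon> A"
| Star: "wf_ctx \<Xi> Map.empty \<Longrightarrow> \<Xi>; Map.empty \<turnstile> Star a \<Colon> One"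
| OneE: "\<Xi>; \<Gamma> \<turnstile> t \<Colon> One \<Longrightarrow> \<Xi>; \<Delta> \<turnstile> u \<Colon> A \<Longrightarrow> disjoint \<Gamma> \<Delta> \<Longrightarrow> \<Xi>; \<Gamma> ++ \<Delta> \<turnstile> OneE t u \<Colon> A"
| Lam: "skip \<Xi>; extend A \<Gamma> \<turnstile> t \<Colon> B \<Longrightarrow> \<Xi>; \<Gamma> \<turnstile> Lam A t \<Colon> Lolli A B"
| App: "\<Xi>; \<Gamma> \<turnstile> t \<Colon> Lolli A B \<Longrightarrow> \<Xi>; \<Delta> \<turnstile> u \<Colon> A \<Longrightarrow> disjoint \<Gamma> \<Delta> \<Longrightarrow> \<Xi>; \<Gamma> ++ \<Delta> \<turnstile> App t u \<Colon> B"
| Tens: "\<Xi>; \<Gamma> \<turnstile> t \<Colon> A \<Longrightarrow> \<Xi>; \<Delta> \<turnstile> u \<Colon> B \<Longrightarrow> disjoint \<Gamma> \<Delta> \<Longrightarrow> \<Xi>; \<Gamma> ++ \<Delta> \<turnstile> Tens t u \<Colon> Tensor A B"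
| TensE: "\<Xi>; \<Gamma> \<turnstile> t \<Colon> Tensor A B \<Longrightarrow> skip (skip \<Xi>); extend B (extend A \<Delta>) \<turnstile> u \<Colon> C \<Longrightarrow>
    disjoint \<Gamma> \<Delta> \<Longrightarrow> \<Xi>; \<Gamma> ++ \<Delta> \<turnstile> TensE t A B u \<Colon> C"
| Unit: "wf_ctx \<Xi> \<Gamma> \<Longrightarrow> \<Xi>; \<Gamma> \<turnstile> Unit \<Colon> Top"
| ZeroE: "\<Xi>; \<Gamma> \<turnstile> t \<Colon> Zero \<Longrightarrow> disjoint \<Gamma> \<Delta> \<Longrightarrow> wf_ctx \<Xi> (\<Gamma> ++ \<Delta>) \<Longrightarrow> \<Xi>; \<Gamma> ++ \<Delta> \<turnstile> ZeroE t \<Colon> C"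
| Pair: "\<Xi>; \<Gamma> \<turnstile> t \<Colon> A \<Longrightarrow> \<Xi>; \<Gamma> \<turnstile> u \<Colon> B \<Longrightarrow> \<Xi>; \<Gamma> \<turnstile> Pair t u \<Colon> With A B"
| With1E: "\<Xi>; \<Gamma> \<turnstile> t \<Colon> With A B \<Longrightarrow> skip \<Xi>; extend A \<Delta> \<turnstile> u \<Colon> C \<Longrightarrow>
    disjoint \<Gamma> \<Delta> \<Longrightarrow> \<Xi>; \<Gamma> ++ \<Delta> \<turnstile> With1E t A u \<Colon> C"
| With2E: "\<Xi>; \<Gamma> \<turnstile> t \<Colon> With A B \<Longrightarrow> skip \<Xi>; extend B \<Delta> \<turnstile> u \<Colon> C \<Longrightarrow>
    disjoint \<Gamma> \<Delta> \<Longrightarrow> \<Xi>; \<Gamma> ++ \<Delta> \<turnstile> With2E t B u \<Colon> C"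
| Inl: "\<Xi>; \<Gamma> \<turnstile> t \<Colon> A \<Longrightarrow> \<Xi>; \<Gamma> \<turnstile> Inl t \<Colon> Plus A B"
| Inr: "\<Xi>; \<Gamma> \<turnstile> t \<Colon> B \<Longrightarrow> \<Xi>; \<Gamma> \<turnstile> Inr t \<Colon> Plus A B"
| PlusE: "\<Xi>; \<Gamma> \<turnstile> t \<Colon> Plus A B \<Longrightarrow> skip \<Xi>; extend A \<Delta> \<turnstile> u \<Colon> C \<Longrightarrow> skip \<Xi>; extend B \<Delta> \<turnstile> v \<Colon> C \<Longrightarrow>
    disjoint \<Gamma> \<Delta> \<Longrightarrow> \<Xi>; \<Gamma> ++ \<Delta> \<turnstile> PlusE t A u B v \<Colon> C"
| Bang: "\<Xi>; Map.empty \<turnstile> t \<Colon> A \<Longrightarrow> \<Xi>; Map.empty \<turnstile> Bang t \<Colon> OfCourse A"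
| BangE: "\<Xi>; \<Gamma> \<turnstile> t \<Colon> OfCourse A \<Longrightarrow> extend A \<Xi>; skip \<Delta> \<turnstile> u \<Colon> B \<Longrightarrow>
    disjoint \<Gamma> \<Delta> \<Longrightarrow> \<Xi>; \<Gamma> ++ \<Delta> \<turnstile> BangE t A u \<Colon> B"
| TLam: "shift \<Xi>; shift \<Gamma> \<turnstile> t \<Colon> A \<Longrightarrow> \<Xi>; \<Gamma> \<turnstile> TLam t \<Colon> Forall A"
| TApp: "\<Xi>; \<Gamma> \<turnstile> t \<Colon> Forall B \<Longrightarrow> \<Xi>; \<Gamma> \<turnstile> TApp t A \<Colon> pinst A B"

lemma dom_extend: "dom (extend A \<Gamma>) = insert 0 (Suc ` dom \<Gamma>)"
proof (rule set_eqI)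
  fix n show "n \<in> dom (extend A \<Gamma>) \<longleftrightarrow> n \<in> insert 0 (Suc ` dom \<Gamma>)"
    by (cases n) (auto simp: extend_def)
qed

lemma dom_skip: "dom (skip \<Gamma>) = Suc ` dom \<Gamma>"
proof (rule set_eqI)
  fix n show "n \<in> dom (skip \<Gamma>) \<longleftrightarrow> n \<in> Suc ` dom \<Gamma>"
    by (cases n) (auto simp: skip_def)
qed

lemma dom_shift: "dom (shift \<Gamma>) = dom \<Gamma>"
  by (auto simp: shift_def dom_def)

lemma wf_ctx_simps:
  "wf_ctx (skip \<Xi>) (extend A \<Gamma>) \<longleftrightarrow> wf_ctx \<Xi> \<Gamma>"
  "wf_ctx (skip (skip \<Xi>)) (extend B (extend A \<Gamma>)) \<longleftrightarrow> wf_ctx \<Xi> \<Gamma>"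
  "wf_ctx (extend A \<Xi>) (skip \<Gamma>) \<longleftrightarrow> wf_ctx \<Xi> \<Gamma>"
  "wf_ctx (shift \<Xi>) (shift \<Gamma>) \<longleftrightarrow> wf_ctx \<Xi> \<Gamma>"
  "wf_ctx \<Xi> (\<Gamma> ++ \<Delta>) \<longleftrightarrow> wf_ctx \<Xi> \<Gamma> \<and> wf_ctx \<Xi> \<Delta>"
  by (auto simp: wf_ctx_def disjoint_def dom_extend dom_skip dom_shift finite_image_iff image_Int[OF inj_Suc, symmetric]
           simp del: dom_eq_empty_conv)

lemma typing_wf_ctx: "\<Xi>; \<Gamma> \<turnstile> t \<Colon> A \<Longrightarrow> wf_ctx \<Xi> \<Gamma>"
  by (induction rule: typing.induct) (simp_all only: wf_ctx_simps simp_thms)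


subsection \<open>Reduction\<close>

text \<open>
  Class \<open>semiring\<close> assumes neither \<open>0\<close> nor \<open>1\<close>; class \<open>semiring_1\<close> would exclude the trivial semiring.
\<close>

inductive reduces :: "'s::semiring trm \<Rightarrow> 's trm \<Rightarrow> bool" (infix "\<leadsto>" 50) where
  "OneE (Star a) t \<leadsto> Scal a t"
| "App (Lam A t) u \<leadsto> inst u t"
| "TensE (Tens u v) A B w \<leadsto> inst2 u v w"
| "With1E (Pair t u) A v \<leadsto> inst t v"
| "With2E (Pair t u) B v \<leadsto> inst u v"
| "PlusE (Inl t) A v B w \<leadsto> inst t v"
| "PlusE (Inr u) A v B w \<leadsto> inst u w"
| "BangE (Bang t) A u \<leadsto> inst t u"
| "TApp (TLam t) A \<leadsto> tinst A t"

| "Sum (Star a) (Star b) \<leadsto> Star (a + b)"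
| "Sum (Lam A t) (Lam A u) \<leadsto> Lam A (Sum t u)"
| "TensE (Sum t u) A B v \<leadsto> Sum (TensE t A B v) (TensE u A B v)"
| "Sum Unit Unit \<leadsto> Unit"
| "Sum (Pair t u) (Pair v w) \<leadsto> Pair (Sum t v) (Sum u w)"
| "PlusE (Sum t u) A v B w \<leadsto> Sum (PlusE t A v B w) (PlusE u A v B w)"
| "Sum (Bang t) (Bang u) \<leadsto> Bang (Sum t u)"
| "Sum (TLam t) (TLam u) \<leadsto> TLam (Sum t u)"

| "Scal a (Star b) \<leadsto> Star (a * b)"
| "Scal a (Lam A t) \<leadsto> Lam A (Scal a t)"
| "TensE (Scal a t) A B v \<leadsto> Scal a (TensE t A B v)"
| "Scal a Unit \<leadsto> Unit"
| "Scal a (Pair t u) \<leadsto> Pair (Scal a t) (Scal a u)"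
| "PlusE (Scal a t) A v B w \<leadsto> Scal a (PlusE t A v B w)"
| "Scal a (Bang t) \<leadsto> Bang (Scal a t)"
| "Scal a (TLam t) \<leadsto> TLam (Scal a t)"

| "t \<leadsto> t' \<Longrightarrow> Sum t u \<leadsto> Sum t' u"
| "u \<leadsto> u' \<Longrightarrow> Sum t u \<leadsto> Sum t u'"
| "t \<leadsto> t' \<Longrightarrow> Scal a t \<leadsto> Scal a t'"
| "t \<leadsto> t' \<Longrightarrow> OneE t u \<leadsto> OneE t' u"
| "u \<leadsto> u' \<Longrightarrow> OneE t u \<leadsto> OneE t u'"
| "t \<leadsto> t' \<Longrightarrow> Lam A t \<leadsto> Lam A t'"
| "t \<leadsto> t' \<Longrightarrow> App t u \<leadsto> App t' u"
| "u \<leadsto> u' \<Longrightarrow> App t u \<leadsto> App t u'"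
| "t \<leadsto> t' \<Longrightarrow> Tens t u \<leadsto> Tens t' u"
| "u \<leadsto> u' \<Longrightarrow> Tens t u \<leadsto> Tens t u'"
| "t \<leadsto> t' \<Longrightarrow> TensE t A B u \<leadsto> TensE t' A B u"
| "u \<leadsto> u' \<Longrightarrow> TensE t A B u \<leadsto> TensE t A B u'"
| "t \<leadsto> t' \<Longrightarrow> ZeroE t \<leadsto> ZeroE t'"
| "t \<leadsto> t' \<Longrightarrow> Pair t u \<leadsto> Pair t' u"
| "u \<leadsto> u' \<Longrightarrow> Pair t u \<leadsto> Pair t u'"
| "t \<leadsto> t' \<Longrightarrow> With1E t A u \<leadsto> With1E t' A u"
| "u \<leadsto> u' \<Longrightarrow> With1E t A u \<leadsto> With1E t A u'"
| "t \<leadsto> t' \<Longrightarrow> With2E t B u \<leadsto> With2E t' B u"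
| "u \<leadsto> u' \<Longrightarrow> With2E t B u \<leadsto> With2E t B u'"
| "t \<leadsto> t' \<Longrightarrow> Inl t \<leadsto> Inl t'"
| "t \<leadsto> t' \<Longrightarrow> Inr t \<leadsto> Inr t'"
| "t \<leadsto> t' \<Longrightarrow> PlusE t A u B v \<leadsto> PlusE t' A u B v"
| "u \<leadsto> u' \<Longrightarrow> PlusE t A u B v \<leadsto> PlusE t A u' B v"
| "v \<leadsto> v' \<Longrightarrow> PlusE t A u B v \<leadsto> PlusE t A u B v'"
| "t \<leadsto> t' \<Longrightarrow> Bang t \<leadsto> Bang t'"
| "t \<leadsto> t' \<Longrightarrow> BangE t A u \<leadsto> BangE t' A u"
| "u \<leadsto> u' \<Longrightarrow> BangE t A u \<leadsto> BangE t A u'"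
| "t \<leadsto> t' \<Longrightarrow> TLam t \<leadsto> TLam t'"
| "t \<leadsto> t' \<Longrightarrow> TApp t A \<leadsto> TApp t' A"

definition closed :: "'s trm \<Rightarrow> bool" where
  "closed t \<longleftrightarrow> fv t = {}"

definition irreducible :: "'s::semiring trm \<Rightarrow> bool" where
  "irreducible t \<longleftrightarrow> (\<nexists>u. t \<leadsto> u)"

text \<open>
  A closed proof-term may be typable in a non-empty context, since the linear context is arbitrary
  in the rules for \<open>Unit\<close> and \<open>ZeroE\<close>; the contexts are therefore left unrestricted.
\<close>

definition closed_irreducible_proof :: "'s::semiring trm \<Rightarrow> lprop \<Rightarrow> bool" where
  "closed_irreducible_proof t A \<longleftrightarrow> closed t \<and> irreducible t \<and> (\<exists>\<Xi> \<Gamma>. \<Xi>; \<Gamma> \<turnstile> t \<Colon> A)"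

end

theory Submission
  imports Defs
begin

text \<open>
  Progress by induction on the typing derivation. In a closed elimination the eliminated proof-term
  is closed and irreducible, so by the induction hypothesis it has one of the shapes for which a
  reduction rule applies. A sum or scalar multiple commutes with every introduction except those of
  \<open>\<otimes>\<close> and \<open>\<oplus>\<close>; for these two connectives it is instead the eliminations that commute with it.
\<close>

text \<open>Recursion on the proposition lets a case split on it unfold the required shape by
  simplification. In the \<open>Lolli\<close> clause the annotation is tied to the proposition,
  because two abstractions under \<open>Sum\<close> form a redex only if their annotations
  agree.\<close>

fun has_intro_shape :: "'s trm \<Rightarrow> lprop \<Rightarrow> bool" where
  "has_intro_shape t (PVar X) \<longleftrightarrow> False"
| "has_intro_shape t One \<longleftrightarrow> (\<exists>a. t = Star a)"
| "has_intro_shape t (Lolli A B) \<longleftrightarrow> (\<exists>u. t = Lam A u)"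
| "has_intro_shape t (Tensor A B) \<longleftrightarrow>
    (\<exists>u v. t = Tens u v) \<or> (\<exists>u v. t = Sum u v) \<or> (\<exists>a u. t = Scal a u)"
| "has_intro_shape t Top \<longleftrightarrow> t = Unit"
| "has_intro_shape t Zero \<longleftrightarrow> False"
| "has_intro_shape t (With A B) \<longleftrightarrow> (\<exists>u v. t = Pair u v)"
| "has_intro_shape t (Plus A B) \<longleftrightarrow>
    (\<exists>u. t = Inl u) \<or> (\<exists>u. t = Inr u) \<or> (\<exists>u v. t = Sum u v) \<or> (\<exists>a u. t = Scal a u)"
| "has_intro_shape t (OfCourse A) \<longleftrightarrow> (\<exists>u. t = Bang u)"
| "has_intro_shape t (Forall A) \<longleftrightarrow> (\<exists>u. t = TLam u)"

text \<open>A step of the subterm would lift through a congruence rule. The subterms listed lie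
  under no binder, so closedness passes to them as well and the induction hypothesis
  applies.\<close>

lemma irreducible_subterm:
  "irreducible (Sum t u) \<Longrightarrow> irreducible t"
  "irreducible (Sum t u) \<Longrightarrow> irreducible u"
  "irreducible (Scal a t) \<Longrightarrow> irreducible t"
  "irreducible (OneE t u) \<Longrightarrow> irreducible t"
  "irreducible (App t u) \<Longrightarrow> irreducible t"
  "irreducible (TensE t A B u) \<Longrightarrow> irreducible t"
  "irreducible (ZeroE t) \<Longrightarrow> irreducible t"
  "irreducible (With1E t A u) \<Longrightarrow> irreducible t"
  "irreducible (With2E t A u) \<Longrightarrow> irreducible t"
  "irreducible (PlusE t A u B v) \<Longrightarrow> irreducible t"
  "irreducible (BangE t A u) \<Longrightarrow> irreducible t"
  "irreducible (TApp t A) \<Longrightarrow> irreducible t"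
  unfolding irreducible_def by (blast intro: reduces.intros)+

lemma not_irreducible_redex:
  "\<not> irreducible (OneE (Star a) t)"
  "\<not> irreducible (App (Lam A t) u)"
  "\<not> irreducible (TensE (Tens t u) A B w)"
  "\<not> irreducible (With1E (Pair t u) A v)"
  "\<not> irreducible (With2E (Pair t u) B v)"
  "\<not> irreducible (PlusE (Inl t) A v B w)"
  "\<not> irreducible (PlusE (Inr t) A v B w)"
  "\<not> irreducible (BangE (Bang t) A u)"
  "\<not> irreducible (TApp (TLam t) A)"
  "\<not> irreducible (Sum (Star a) (Star b))"
  "\<not> irreducible (Sum (Lam A t) (Lam A u))"
  "\<not> irreducible (TensE (Sum t u) A B v)"
  "\<not> irreducible (Sum Unit Unit)"
  "\<not> irreducible (Sum (Pair t u) (Pair v w))"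
  "\<not> irreducible (PlusE (Sum t u) A v B w)"
  "\<not> irreducible (Sum (Bang t) (Bang u))"
  "\<not> irreducible (Sum (TLam t) (TLam u))"
  "\<not> irreducible (Scal a (Star b))"
  "\<not> irreducible (Scal a (Lam A t))"
  "\<not> irreducible (TensE (Scal a t) A B v)"
  "\<not> irreducible (Scal a Unit)"
  "\<not> irreducible (Scal a (Pair t u))"
  "\<not> irreducible (PlusE (Scal a t) A v B w)"
  "\<not> irreducible (Scal a (Bang t))"
  "\<not> irreducible (Scal a (TLam t))"
  unfolding irreducible_def by (blast intro: reduces.intros)+

text \<open>The induction carries \<open>fv t = {}\<close> and leaves the contexts arbitrary: this
  already excludes both variable axioms.\<close>

lemma has_intro_shape_if_closed_irreducible:
  fixes t :: "'s::semiring trm"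
  assumes "\<Xi>; \<Gamma> \<turnstile> t \<Colon> A" "fv t = {}" "irreducible t"
  shows "has_intro_shape t A"
  using assms
proof (induction rule: typing.induct)
  case (Sum \<Xi> \<Gamma> t A u)
  then have "has_intro_shape t A" "has_intro_shape u A"
    by (auto dest: irreducible_subterm)
  \<comment> \<open>For \<open>Tensor\<close> and \<open>Plus\<close> the sum itself is an allowed
    shape; for \<open>PVar\<close> and \<open>Zero\<close> the induction hypothesis is absurd;
    otherwise both summands are the same introduction, so the sum is a redex.\<close>
  then show ?case
    using Sum.prems(2) by (cases A) (auto simp: not_irreducible_redex)
next
  case (Scal \<Xi> \<Gamma> t A a)
  then have "has_intro_shape t A"
    by (auto dest: irreducible_subterm)
  then show ?case
    using Scal.prems(2) by (cases A) (auto simp: not_irreducible_redex)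
\<comment> \<open>Introductions have the required shape outright. An elimination is contradictory
  whatever its type: its principal subterm either makes it a redex or, for \<open>ZeroE\<close>,
  would have a shape at \<open>Zero\<close>. The \<open>frule\<close> is optional since it applies
  only to eliminations.\<close>
qed (((frule irreducible_subterm)?, fastforce simp: not_irreducible_redex)+)

theorem theorem4:
  fixes t :: "'s::semiring trm" and A :: lprop
  assumes "closed_irreducible_proof t A"
  shows "(\<forall>X. A \<noteq> PVar X)
    \<and> (A = One \<longrightarrow> (\<exists>a. t = Star a))
    \<and> (\<forall>B C. A = Lolli B C \<longrightarrow> (\<exists>u. t = Lam B u))
    \<and> (\<forall>B C. A = Tensor B C \<longrightarrow>
          (\<exists>u v. t = Tens u v) \<or> (\<exists>u v. t = Sum u v) \<or> (\<exists>a u. t = Scal a u))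
    \<and> (A = Top \<longrightarrow> t = Unit)
    \<and> A \<noteq> Zero
    \<and> (\<forall>B C. A = With B C \<longrightarrow> (\<exists>u v. t = Pair u v))
    \<and> (\<forall>B C. A = Plus B C \<longrightarrow>
          (\<exists>u. t = Inl u) \<or> (\<exists>u. t = Inr u) \<or> (\<exists>u v. t = Sum u v) \<or> (\<exists>a u. t = Scal a u))
    \<and> (\<forall>B. A = OfCourse B \<longrightarrow> (\<exists>u. t = Bang u))
    \<and> (\<forall>B. A = Forall B \<longrightarrow> (\<exists>u. t = TLam u))"
proof -
  have "has_intro_shape t A"
    using assms has_intro_shape_if_closed_irreducible
    unfolding closed_irreducible_proof_def closed_def by blast
  then show ?thesis
    by (cases A) auto
qed

end
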